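(* Let $k\geq 2$ be an integer, let $\mathcal{R}$ be a commutative ring with identity, and let $\mathcal{G}=\begin{bmatrix} A & M\\ N & B\end{bmatrix}$ be a $2$-torsion free generalized matrix algebra over $\mathcal{R}$ such that $M$ is faithful as a left $A$-module and also as a right $B$-module. Let $\Theta\colon\mathcal{G}\to\mathcal{G}$ be a $k$-commuting mapping of $\mathcal{G}$. Suppose that the following three conditions are satisfied: (1) $\mathcal{Z}(A)_k=\pi_A(\mathcal{Z}(\mathcal{G}))$; (2) $\mathcal{Z}(B)_k=\pi_B(\mathcal{Z}(\mathcal{G}))$; (3) there exist $m_0\in M$ and $n_0\in N$ such that $$\mathcal{Z}(\mathcal{G})=\left\{\begin{bmatrix} a & 0\\ 0 & b\end{bmatrix} \;\middle|\; a\in\mathcal{Z}(A),\ b\in\mathcal{Z}(B),\ am_0=m_0b,\ n_0a=bn_0\right\}.$$ Then $\Theta$ is proper; that is, there exist $\lambda\in\mathcal{Z}(\mathcal{G})$ and an $\mathcal{R}$-linear mapping $\zeta\colon\mathcal{G}\to\mathcal{Z}(\mathcal{G})$ such that $\Theta(X)=\lambda X+\zeta(X)$ for all $X\in\mathcal{G}$.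
   Context: Generalized matrix algebra: let $\mathcal{R}$ be a commutative ring with identity, $A,B$ unital associative $\mathcal{R}$-algebras, $M$ an $(A,B)$-bimodule, $N$ a $(B,A)$-bimodule, together with bimodule homomorphisms $M\otimes_B N\to A$, $m\otimes n\mapsto mn$, and $N\otimes_A M\to B$, $n\otimes m\mapsto nm$, satisfying $(mn)m'=m(nm')$ and $(nm)n'=n(mn')$ for all $m,m'\in M$, $n,n'\in N$ (a Morita context). At least one of $M,N$ is nonzero. The set $\mathcal{G}$ of matrices $\begin{bmatrix} a & m\\ n & b\end{bmatrix}$ ($a\in A,m\in M,n\in N,b\in B$), with matrix-like addition and multiplication, is a unital associative $\mathcal{R}$-algebra called a generalized matrix algebra (of order 2). For an associative algebra $\mathcal{A}$: $[a,b]_0=a$, $[a,b]_1=ab-ba$, $[a,b]_k=[[a,b]_{k-1},b]$. $\mathcal{Z}(\mathcal{A})$ is the center of $\mathcal{A}$ and $\mathcal{Z}(\mathcal{A})_k=\{a\in\mathcal{A}\mid [a,x]_k=0\ \forall x\in\mathcal{A}\}$. An $\mathcal{R}$-linear mapping $\Theta\colon\mathcal{A}\to\mathcal{A}$ is $k$-commuting if $[\Theta(a),a]_k=0$ for all $a\in\mathcal{A}$. $\pi_A\colon\mathcal{G}\to A$ and $\pi_B\colon\mathcal{G}\to B$ are the projections sending $\begin{bmatrix} a & m\\ n & b\end{bmatrix}$ to $a$ and to $b$ respectively. $2$-torsion free means: $2x=0$ implies $x=0$. *)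

theory Defs
  imports Complex_Main "HOL-Library.Product_Plus"
begin

text \<open>The multiplication is a parameter because the multiplication of a generalized matrix
  algebra depends on its Morita context and so cannot come from a type class.\<close>

locale unital_algebra = module scale
  for scale :: "'r::comm_ring_1 \<Rightarrow> 'x::ab_group_add \<Rightarrow> 'x" +
  fixes mult :: "'x \<Rightarrow> 'x \<Rightarrow> 'x" and unit :: 'x
  assumes mult_assoc: "mult (mult x y) z = mult x (mult y z)"
    and mult_add_left: "mult (x + y) z = mult x z + mult y z"
    and mult_add_right: "mult x (y + z) = mult x y + mult x z"
    and unit_left: "mult unit x = x"
    and unit_right: "mult x unit = x"
    and mult_scale_left: "mult (scale r x) y = scale r (mult x y)"
    and mult_scale_right: "mult x (scale r y) = scale r (mult x y)"

primrec bracket :: "('x::ab_group_add \<Rightarrow> 'x \<Rightarrow> 'x) \<Rightarrow> nat \<Rightarrow> 'x \<Rightarrow> 'x \<Rightarrow> 'x" where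
  "bracket mult 0 a b = a"
| "bracket mult (Suc k) a b = mult (bracket mult k a b) b - mult b (bracket mult k a b)"

definition center :: "('x \<Rightarrow> 'x \<Rightarrow> 'x) \<Rightarrow> 'x set" where
  "center mult = {a. \<forall>x. mult a x = mult x a}"

definition kcenter :: "('x::ab_group_add \<Rightarrow> 'x \<Rightarrow> 'x) \<Rightarrow> nat \<Rightarrow> 'x set" where
  "kcenter mult k = {a. \<forall>x. bracket mult k a x = 0}"

definition k_commuting ::
  "('r::comm_ring_1 \<Rightarrow> 'x::ab_group_add \<Rightarrow> 'x) \<Rightarrow> ('x \<Rightarrow> 'x \<Rightarrow> 'x) \<Rightarrow> nat \<Rightarrow> ('x \<Rightarrow> 'x) \<Rightarrow> bool" where
  "k_commuting scale mult k \<Theta> \<longleftrightarrow>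
     module_hom scale scale \<Theta> \<and> (\<forall>a. bracket mult k (\<Theta> a) a = 0)"

text \<open>Unital bimodules over two algebras on which the two induced actions of the base ring agree.\<close>

locale bimodule = module scaleM
  for scaleM :: "'r::comm_ring_1 \<Rightarrow> 'm::ab_group_add \<Rightarrow> 'm" +
  fixes scaleA :: "'r \<Rightarrow> 'a::ring_1 \<Rightarrow> 'a"
    and scaleB :: "'r \<Rightarrow> 'b::ring_1 \<Rightarrow> 'b"
    and lact :: "'a \<Rightarrow> 'm \<Rightarrow> 'm"
    and ract :: "'m \<Rightarrow> 'b \<Rightarrow> 'm"
  assumes lact_add_left: "lact (a + a') m = lact a m + lact a' m"
    and lact_add_right: "lact a (m + m') = lact a m + lact a m'"
    and lact_mult: "lact (a * a') m = lact a (lact a' m)"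
    and lact_one: "lact 1 m = m"
    and lact_scale_left: "lact (scaleA r a) m = scaleM r (lact a m)"
    and lact_scale_right: "lact a (scaleM r m) = scaleM r (lact a m)"
    and ract_add_left: "ract (m + m') b = ract m b + ract m' b"
    and ract_add_right: "ract m (b + b') = ract m b + ract m b'"
    and ract_mult: "ract m (b * b') = ract (ract m b) b'"
    and ract_one: "ract m 1 = m"
    and ract_scale_left: "ract (scaleM r m) b = scaleM r (ract m b)"
    and ract_scale_right: "ract m (scaleB r b) = scaleM r (ract m b)"
    and lact_ract: "ract (lact a m) b = lact a (ract m b)"

record ('r, 'a, 'b, 'm, 'n) morita =
  scaleA :: "'r \<Rightarrow> 'a \<Rightarrow> 'a"
  scaleB :: "'r \<Rightarrow> 'b \<Rightarrow> 'b"
  scaleM :: "'r \<Rightarrow> 'm \<Rightarrow> 'm"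
  scaleN :: "'r \<Rightarrow> 'n \<Rightarrow> 'n"
  actAM :: "'a \<Rightarrow> 'm \<Rightarrow> 'm"
  actMB :: "'m \<Rightarrow> 'b \<Rightarrow> 'm"
  actBN :: "'b \<Rightarrow> 'n \<Rightarrow> 'n"
  actNA :: "'n \<Rightarrow> 'a \<Rightarrow> 'n"
  prodMN :: "'m \<Rightarrow> 'n \<Rightarrow> 'a"
  prodNM :: "'n \<Rightarrow> 'm \<Rightarrow> 'b"

text \<open>A bimodule homomorphism from the tensor product of M and N over B to A is given, via the
  universal property, as a biadditive B-balanced map \<open>prodMN\<close> that is A-linear on either side;
  likewise \<open>prodNM\<close>. The class \<open>ring_1\<close> excludes zero rings; this loses nothing,
  since M and N are unital and not both zero, which forces A and B (hence the base ring) to be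
  nonzero.\<close>

locale generalized_matrix_algebra =
  fixes G :: "('r::comm_ring_1, 'a::ring_1, 'b::ring_1, 'm::ab_group_add, 'n::ab_group_add) morita"
  assumes algebra_A: "unital_algebra (scaleA G) (*) 1"
    and algebra_B: "unital_algebra (scaleB G) (*) 1"
    and bimodule_M: "bimodule (scaleM G) (scaleA G) (scaleB G) (actAM G) (actMB G)"
    and bimodule_N: "bimodule (scaleN G) (scaleB G) (scaleA G) (actBN G) (actNA G)"
    and MN_add_left: "prodMN G (m + m') n = prodMN G m n + prodMN G m' n"
    and MN_add_right: "prodMN G m (n + n') = prodMN G m n + prodMN G m n'"
    and MN_balanced: "prodMN G (actMB G m b) n = prodMN G m (actBN G b n)"
    and MN_left: "prodMN G (actAM G a m) n = a * prodMN G m n"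
    and MN_right: "prodMN G m (actNA G n a) = prodMN G m n * a"
    and NM_add_left: "prodNM G (n + n') m = prodNM G n m + prodNM G n' m"
    and NM_add_right: "prodNM G n (m + m') = prodNM G n m + prodNM G n m'"
    and NM_balanced: "prodNM G (actNA G n a) m = prodNM G n (actAM G a m)"
    and NM_left: "prodNM G (actBN G b n) m = b * prodNM G n m"
    and NM_right: "prodNM G n (actMB G m b) = prodNM G n m * b"
    and MNM: "actAM G (prodMN G m n) m' = actMB G m (prodNM G n m')"
    and NMN: "actBN G (prodNM G n m) n' = actNA G n (prodMN G m n')"
    and nontrivial: "(\<exists>m::'m. m \<noteq> 0) \<or> (\<exists>n::'n. n \<noteq> 0)"

text \<open>The tuple \<open>(a, m, n, b)\<close> is the matrix with rows \<open>(a, m)\<close> and \<open>(n, b)\<close>;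
  addition is componentwise.\<close>

type_synonym ('a, 'b, 'm, 'n) gmat = "'a \<times> 'm \<times> 'n \<times> 'b"

fun gm_scale :: "('r, 'a, 'b, 'm, 'n) morita \<Rightarrow> 'r \<Rightarrow> ('a, 'b, 'm, 'n) gmat \<Rightarrow> ('a, 'b, 'm, 'n) gmat" where
  "gm_scale G r (a, m, n, b) = (scaleA G r a, scaleM G r m, scaleN G r n, scaleB G r b)"

fun gm_mult :: "('r, 'a::ring_1, 'b::ring_1, 'm::ab_group_add, 'n::ab_group_add) morita \<Rightarrow>
    ('a, 'b, 'm, 'n) gmat \<Rightarrow> ('a, 'b, 'm, 'n) gmat \<Rightarrow> ('a, 'b, 'm, 'n) gmat" where
  "gm_mult G (a, m, n, b) (a', m', n', b') =
     (a * a' + prodMN G m n', actAM G a m' + actMB G m b',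
      actNA G n a' + actBN G b n', prodNM G n m' + b * b')"

fun proj_A :: "('a, 'b, 'm, 'n) gmat \<Rightarrow> 'a" where
  "proj_A (a, m, n, b) = a"

fun proj_B :: "('a, 'b, 'm, 'n) gmat \<Rightarrow> 'b" where
  "proj_B (a, m, n, b) = b"

lemma (in generalized_matrix_algebra) gm_unital_algebra:
  "unital_algebra (gm_scale G) (gm_mult G) (1, 0, 0, 1)"
proof -
  interpret A: unital_algebra "scaleA G" "(*)" 1 by (rule algebra_A)
  interpret B: unital_algebra "scaleB G" "(*)" 1 by (rule algebra_B)
  interpret M: bimodule "scaleM G" "scaleA G" "scaleB G" "actAM G" "actMB G" by (rule bimodule_M)
  interpret N: bimodule "scaleN G" "scaleB G" "scaleA G" "actBN G" "actNA G" by (rule bimodule_N)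
  have z: "actAM G a 0 = 0" "actAM G 0 m = 0" "actMB G m 0 = 0" "actMB G 0 b = 0"
    "actBN G b 0 = 0" "actBN G 0 n = 0" "actNA G n 0 = 0" "actNA G 0 a = 0"
    "prodMN G 0 n = 0" "prodMN G m 0 = 0" "prodNM G 0 m = 0" "prodNM G n 0 = 0" for a b m n
    using M.lact_add_right[of a 0 0] M.lact_add_left[of 0 0 m] M.ract_add_right[of m 0 0]
      M.ract_add_left[of 0 0 b] N.lact_add_right[of b 0 0] N.lact_add_left[of 0 0 n]
      N.ract_add_right[of n 0 0] N.ract_add_left[of 0 0 a]
      MN_add_left[of 0 0 n] MN_add_right[of m 0 0] NM_add_left[of 0 0 m] NM_add_right[of n 0 0]
    by simp_all
  have sMN: "prodMN G (scaleM G r m) n = scaleA G r (prodMN G m n)"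
    "prodMN G m (scaleN G r n) = scaleA G r (prodMN G m n)" for r m n
    using MN_left[of "scaleA G r 1" m n] M.lact_scale_left[of r 1 m]
      MN_right[of m n "scaleA G r 1"] N.ract_scale_right[of n r 1]
      A.mult_scale_left[of r 1] A.mult_scale_right[of _ r 1]
    by (simp_all add: M.lact_one N.ract_one)
  have sNM: "prodNM G (scaleN G r n) m = scaleB G r (prodNM G n m)"
    "prodNM G n (scaleM G r m) = scaleB G r (prodNM G n m)" for r m n
    using NM_left[of "scaleB G r 1" n m] N.lact_scale_left[of r 1 n]
      NM_right[of n m "scaleB G r 1"] M.ract_scale_right[of m r 1]
      B.mult_scale_left[of r 1] B.mult_scale_right[of _ r 1]
    by (simp_all add: M.ract_one N.lact_one)
  show ?thesis
    by unfold_locales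
      (auto simp: z sMN sNM A.scale_right_distrib A.scale_left_distrib B.scale_right_distrib
        B.scale_left_distrib M.scale_right_distrib M.scale_left_distrib N.scale_right_distrib
        N.scale_left_distrib M.lact_add_left M.lact_add_right M.ract_add_left M.ract_add_right
        N.lact_add_left N.lact_add_right N.ract_add_left N.ract_add_right
        M.lact_mult M.ract_mult N.lact_mult N.ract_mult M.lact_one M.ract_one N.lact_one N.ract_one
        M.lact_scale_left M.lact_scale_right M.ract_scale_left M.ract_scale_right
        N.lact_scale_left N.lact_scale_right N.ract_scale_left N.ract_scale_right
        M.lact_ract N.lact_ract MN_add_left MN_add_right NM_add_left NM_add_right
        MN_balanced NM_balanced MN_left MN_right NM_left NM_right MNM NMN
        A.mult_scale_left A.mult_scale_right B.mult_scale_left B.mult_scale_right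
        algebra_simps)
qed

end

theory Submission
  imports Defs
begin

text \<open>If \<open>p\<close> is idempotent, \<open>[\<Theta>(p), p]\<^sub>k = 0\<close> already forces \<open>\<Theta>(p)\<close> to commute with \<open>p\<close>. Applied to
  \<open>e + m\<close>, \<open>e + n\<close>, \<open>f + m\<close> and \<open>f + n\<close>, where \<open>e\<close> and \<open>f\<close> are the diagonal idempotents, this shows that
  off the diagonal \<open>\<Theta>\<close> acts on \<open>M\<close> and \<open>N\<close> as multiplication by a central element \<open>\<lambda>\<close>. Elements of \<open>A\<close>
  and \<open>B\<close> have diagonal images: an off-diagonal entry \<open>u\<close> of \<open>\<Theta>(a)\<close> satisfies
  \<open>a\<^sup>k u = 0 = (1 - a)\<^sup>k u\<close>, by considering \<open>a\<close> and \<open>a + f\<close>. So \<open>\<zeta> = \<Theta> - \<lambda>\<close> is \<open>k\<close>-commuting with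
  diagonal values.

  That \<open>\<zeta>\<close> is central on \<open>A\<close> and \<open>B\<close> follows by the same comaximality trick, applied to unipotent
  conjugates of diagonal matrices. On \<open>N\<close> it follows from the idempotents obtained by conjugating \<open>e\<close>
  with both an upper and a lower unipotent; these also give half of the claim on \<open>M\<close>. For the other half,
  \<open>\<zeta>(m)m = m\<zeta>(m)\<close> and condition (3) make \<open>\<zeta>(m\<^sub>0)\<close> central, and linearizing the identity then yields
  \<open>\<zeta>(m)m\<^sub>0 = m\<^sub>0\<zeta>(m)\<close>, so that (3) applies to \<open>\<zeta>(m)\<close>.\<close>

text \<open>The polynomials \<open>t ^ i\<close> and \<open>(t + 1) ^ j\<close> are comaximal over the integers.\<close>

lemma funpow_comaximal:
  fixes T :: "'x::ab_group_add \<Rightarrow> 'x"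
  assumes add: "\<And>x y. T (x + y) = T x + T y"
    and "(T ^^ i) u = 0" and "((\<lambda>x. T x + x) ^^ j) u = 0"
  shows "u = 0"
  using assms(2,3)
proof (induction i arbitrary: u)
  case 0
  then show ?case by simp
next
  case (Suc i)
  let ?S = "\<lambda>x. T x + x"
  have comm: "(?S ^^ j) (T x) = T ((?S ^^ j) x)" for x
    by (induction j) (auto simp: add)
  have "T 0 = 0" using add[of 0 0] by simp
  \<comment> \<open>Since \<open>(T + 1) ^ j\<close> commutes with \<open>T\<close>, the induction
    hypothesis applies to \<open>T u\<close>. Once \<open>T u = 0\<close>, the operator
    \<open>T + 1\<close> fixes \<open>u\<close>.\<close>
  then have "T u = 0"
    using Suc comm[of u] by (simp add: funpow_swap1)
  then have "(?S ^^ j) u = u" by (induction j) auto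
  then show ?case using Suc.prems(2) by simp
qed

section \<open>Iterated brackets in a unital algebra\<close>

context unital_algebra
begin

lemma mult_zero_left [simp]: "mult 0 x = 0"
  using mult_add_left[of 0 0 x] by simp

lemma mult_zero_right [simp]: "mult x 0 = 0"
  using mult_add_right[of x 0 0] by simp

lemma mult_diff_left: "mult (x - y) z = mult x z - mult y z"
  using mult_add_left[of "x - y" y z] by (simp add: algebra_simps)

lemma mult_diff_right: "mult x (y - z) = mult x y - mult x z"
  using mult_add_right[of x "y - z" z] by (simp add: algebra_simps)

lemma bracket_diff: "bracket mult j (x - y) z = bracket mult j x z - bracket mult j y z"
  by (induction j) (simp_all add: mult_diff_left mult_diff_right)

lemma bracket_zero [simp]: "bracket mult j 0 z = 0"
  by (induction j) simp_all

lemma bracket_add: "bracket mult j (x + y) z = bracket mult j x z + bracket mult j y z"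
  using bracket_diff[of j "x + y" y z] by (simp add: algebra_simps)

lemma bracket_commuting_eq_0:
  assumes "mult x y = mult y x" and "j \<ge> 1"
  shows "bracket mult j x y = 0"
  using assms(2)
proof (induction j rule: dec_induct)
  case base
  show ?case using assms(1) by simp
qed simp

text \<open>When \<open>h g = 1\<close>, the map sending \<open>x\<close> to \<open>g x h\<close>
  preserves products and differences, hence all brackets.\<close>

lemma bracket_conjugate:
  assumes "mult h g = unit"
  shows "bracket mult j (mult (mult g y) h) (mult (mult g x) h) = mult (mult g (bracket mult j y x)) h"
proof (induction j)
  case (Suc j)
  have conj: "mult (mult (mult g x) h) (mult (mult g z) h) = mult (mult g (mult x z)) h" for x z
  proof -
    have "mult h (mult g w) = w" for w
      using assms by (simp flip: mult_assoc add: unit_left)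
    then show ?thesis by (simp add: mult_assoc)
  qed
  show ?case
    by (simp add: Suc conj mult_diff_left mult_diff_right)
qed simp

text \<open>For an idempotent \<open>p\<close> the inner derivation \<open>ad p\<close> satisfies \<open>(ad p)\<^sup>3 = ad p\<close>.\<close>

lemma bracket_idempotent_commute:
  assumes p: "mult p p = p" and "bracket mult j y p = 0" and "j \<ge> 1"
  shows "mult y p = mult p y"
  using assms(3,2)
proof (induction j rule: dec_induct)
  case base
  then show ?case by simp
next
  case (step j)
  then obtain i where j: "j = Suc i" by (cases j) auto
  define z where "z = bracket mult i y p"
  have pp: "mult p (mult p x) = mult p x" for x
    using p by (simp flip: mult_assoc)
  \<comment> \<open>This reads \<open>zp - 2pzp + pz = 0\<close>. Multiplying by \<open>p\<close> on
    the left gives \<open>pz = pzp\<close>, on the right \<open>zp = pzp\<close>, so the bracket one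
    step earlier already vanishes.\<close>
  have eq: "mult (mult z p - mult p z) p - mult p (mult z p - mult p z) = 0"
    using step.prems by (simp add: j z_def)
  have "mult p (mult z p) = mult p z"
    using arg_cong[OF eq, of "mult p"] by (simp add: mult_diff_left mult_diff_right mult_assoc p pp)
  moreover have "mult p (mult z p) = mult z p"
    using arg_cong[OF eq, of "\<lambda>x. mult x p"]
    by (simp add: mult_diff_left mult_diff_right mult_assoc p pp)
  ultimately have "bracket mult j y p = 0"
    by (simp add: j flip: z_def)
  then show ?case using step.IH by simp
qed

lemma center_add: "x \<in> center mult \<Longrightarrow> y \<in> center mult \<Longrightarrow> x + y \<in> center mult"
  by (simp add: center_def mult_add_left mult_add_right)

end

section \<open>Arithmetic, center and brackets of the matrix algebra\<close>

sublocale generalized_matrix_algebra \<subseteq> A: unital_algebra "scaleA G" "(*)" 1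
  by (rule algebra_A)

sublocale generalized_matrix_algebra \<subseteq> B: unital_algebra "scaleB G" "(*)" 1
  by (rule algebra_B)

sublocale generalized_matrix_algebra \<subseteq>
    M: bimodule "scaleM G" "scaleA G" "scaleB G" "actAM G" "actMB G"
  by (rule bimodule_M)

sublocale generalized_matrix_algebra \<subseteq>
    N: bimodule "scaleN G" "scaleB G" "scaleA G" "actBN G" "actNA G"
  by (rule bimodule_N)

sublocale generalized_matrix_algebra \<subseteq> gm: unital_algebra "gm_scale G" "gm_mult G" "(1, 0, 0, 1)"
  by (rule gm_unital_algebra)

context bimodule
begin

lemma lact_zero_left [simp]: "lact 0 m = 0" using lact_add_left[of 0 0 m] by simp
lemma lact_zero_right [simp]: "lact a 0 = 0" using lact_add_right[of a 0 0] by simp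
lemma ract_zero_left [simp]: "ract 0 b = 0" using ract_add_left[of 0 0 b] by simp
lemma ract_zero_right [simp]: "ract m 0 = 0" using ract_add_right[of m 0 0] by simp

lemma lact_diff_left: "lact (a - a') m = lact a m - lact a' m"
  using lact_add_left[of "a - a'" a' m] by (simp add: algebra_simps)
lemma lact_diff_right: "lact a (m - m') = lact a m - lact a m'"
  using lact_add_right[of a "m - m'" m'] by (simp add: algebra_simps)
lemma ract_diff_left: "ract (m - m') b = ract m b - ract m' b"
  using ract_add_left[of "m - m'" m' b] by (simp add: algebra_simps)
lemma ract_diff_right: "ract m (b - b') = ract m b - ract m b'"
  using ract_add_right[of m "b - b'" b'] by (simp add: algebra_simps)

lemma lact_minus_left: "lact (- a) m = - lact a m" using lact_diff_left[of 0 a m] by simp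
lemma lact_minus_right: "lact a (- m) = - lact a m" using lact_diff_right[of a 0 m] by simp
lemma ract_minus_left: "ract (- m) b = - ract m b" using ract_diff_left[of 0 m b] by simp
lemma ract_minus_right: "ract m (- b) = - ract m b" using ract_diff_right[of m 0 b] by simp

lemmas act_simps = lact_one ract_one
  lact_add_left lact_add_right ract_add_left ract_add_right
  lact_diff_left lact_diff_right ract_diff_left ract_diff_right
  lact_minus_left lact_minus_right ract_minus_left ract_minus_right

end

context generalized_matrix_algebra
begin

lemma MN_zero [simp]: "prodMN G 0 n = 0" "prodMN G m 0 = 0"
  using MN_add_left[of 0 0 n] MN_add_right[of m 0 0] by simp_all

lemma NM_zero [simp]: "prodNM G 0 m = 0" "prodNM G n 0 = 0"
  using NM_add_left[of 0 0 m] NM_add_right[of n 0 0] by simp_all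

lemma MN_minus: "prodMN G (- m) n = - prodMN G m n" "prodMN G m (- n) = - prodMN G m n"
  using MN_add_left[of m "- m" n] MN_add_right[of m n "- n"]
  by (simp_all add: eq_neg_iff_add_eq_0 add.commute)

lemma NM_minus: "prodNM G (- n) m = - prodNM G n m" "prodNM G n (- m) = - prodNM G n m"
  using NM_add_left[of n "- n" m] NM_add_right[of n m "- m"]
  by (simp_all add: eq_neg_iff_add_eq_0 add.commute)

lemma MN_diff_right: "prodMN G m (n - n') = prodMN G m n - prodMN G m n'"
  using MN_add_right[of m n "- n'"] by (simp add: MN_minus)

lemma NM_diff_left: "prodNM G (n - n') m = prodNM G n m - prodNM G n' m"
  using NM_add_left[of n "- n'" m] by (simp add: NM_minus)

lemmas gma_simps = M.act_simps N.act_simps MN_minus NM_minus MN_diff_right NM_diff_left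
  MN_add_left MN_add_right NM_add_left NM_add_right

lemma center_iff:
  "(a, m, n, b) \<in> center (gm_mult G) \<longleftrightarrow>
     m = 0 \<and> n = 0 \<and> a \<in> center (*) \<and> b \<in> center (*) \<and>
     (\<forall>m. actAM G a m = actMB G m b) \<and> (\<forall>n. actNA G n a = actBN G b n)"
    (is "?lhs \<longleftrightarrow> ?rhs")
proof
  assume ?lhs
  then have eq: "gm_mult G (a, m, n, b) X = gm_mult G X (a, m, n, b)" for X
    unfolding center_def by blast
  have "m = 0" "n = 0"
    using eq[of "(1, 0, 0, 0)"] by (simp_all add: M.act_simps N.act_simps)
  moreover have "a * x = x * a" for x using eq[of "(x, 0, 0, 0)"] by simp
  moreover have "b * x = x * b" for x using eq[of "(0, 0, 0, x)"] by simp
  moreover have "actAM G a x = actMB G x b" for x using eq[of "(0, x, 0, 0)"] by simp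
  moreover have "actNA G x a = actBN G b x" for x using eq[of "(0, 0, x, 0)"] by simp
  ultimately show ?rhs by (simp add: center_def)
qed (auto simp: center_def)

lemma center_cases:
  assumes "X \<in> center (gm_mult G)"
  obtains a b where "X = (a, 0, 0, b)" "a \<in> center (*)" "b \<in> center (*)"
    "\<And>m. actAM G a m = actMB G m b" "\<And>n. actNA G n a = actBN G b n"
  using assms by (cases X) (simp add: center_iff)

text \<open>A diagonal second argument keeps the four corners apart. The off-diagonal entries appear
  as powers of additive operators, the form that \<open>funpow_comaximal\<close> accepts.\<close>

lemma bracket_diagonal:
  "bracket (gm_mult G) j (y, u, v, z) (a, 0, 0, b) =
     (bracket (*) j y a, ((\<lambda>u. actMB G u b - actAM G a u) ^^ j) u,
      ((\<lambda>v. actNA G v a - actBN G b v) ^^ j) v, bracket (*) j z b)"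
  by (induction j) simp_all

text \<open>Between upper triangular matrices no product of \<open>M\<close> with \<open>N\<close>
  arises, so the diagonal entries bracket separately. Only these are used later, hence the
  unspecified \<open>w\<close>.\<close>

lemma bracket_upper:
  "\<exists>w. bracket (gm_mult G) j (y, u, 0, z) (a, m, 0, b) = (bracket (*) j y a, w, 0, bracket (*) j z b)"
proof (induction j)
  case (Suc j)
  then obtain w where "bracket (gm_mult G) j (y, u, 0, z) (a, m, 0, b) =
      (bracket (*) j y a, w, 0, bracket (*) j z b)" by blast
  then show ?case by simp
qed simp

lemma bracket_lower:
  "\<exists>w. bracket (gm_mult G) j (y, 0, v, z) (a, 0, n, b) = (bracket (*) j y a, 0, w, bracket (*) j z b)"
proof (induction j)
  case (Suc j)
  then obtain w where "bracket (gm_mult G) j (y, 0, v, z) (a, 0, n, b) =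
      (bracket (*) j y a, 0, w, bracket (*) j z b)" by blast
  then show ?case by simp
qed simp

text \<open>The matrix \<open>(a, aw - wb, 0, b)\<close> is conjugate to \<open>diag(a, b)\<close> by the unipotent \<open>(1, w, 0, 1)\<close>.\<close>

lemma bracket_conjugate_diagonal:
  assumes "bracket (gm_mult G) j (p, 0, 0, q) (a, actAM G a w - actMB G w b, 0, b) = 0"
  shows "((\<lambda>u. actMB G u b - actAM G a u) ^^ j) (actMB G w q - actAM G p w) = 0"
proof -
  let ?g = "(1, w, 0, 1)" and ?h = "(1, - w, 0, 1)"
  let ?X = "(a, actAM G a w - actMB G w b, 0, b)"
  have "gm_mult G ?h ?g = (1, 0, 0, 1)"
    by (simp add: gma_simps)
  from gm.bracket_conjugate[OF this, of j "(p, 0, 0, q)" ?X] assms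
  have "bracket (gm_mult G) j (gm_mult G (gm_mult G ?g (p, 0, 0, q)) ?h)
      (gm_mult G (gm_mult G ?g ?X) ?h) = 0"
    by (simp del: gm_mult.simps)
  moreover have "gm_mult G (gm_mult G ?g (p, 0, 0, q)) ?h = (p, actMB G w q - actAM G p w, 0, q)"
    by (simp add: gma_simps)
  moreover have "gm_mult G (gm_mult G ?g ?X) ?h = (a, 0, 0, b)"
    by (simp add: gma_simps)
  ultimately show ?thesis by (simp add: bracket_diagonal zero_prod_def)
qed

end

section \<open>Images of the four corners under a k-commuting map, and the multiplier\<close>

locale k_commuting_gma = generalized_matrix_algebra G
  for G :: "('r::comm_ring_1, 'a::ring_1, 'b::ring_1, 'm::ab_group_add, 'n::ab_group_add) morita" +
  fixes k :: nat and \<Theta> :: "('a, 'b, 'm, 'n) gmat \<Rightarrow> ('a, 'b, 'm, 'n) gmat"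
  assumes k_pos: "k \<ge> 1"
    and torsion_M: "\<And>x::'m. x + x = 0 \<Longrightarrow> x = 0"
    and torsion_N: "\<And>x::'n. x + x = 0 \<Longrightarrow> x = 0"
    and faithful_A: "\<And>a. (\<And>m. actAM G a m = 0) \<Longrightarrow> a = 0"
    and faithful_B: "\<And>b. (\<And>m. actMB G m b = 0) \<Longrightarrow> b = 0"
    and map_add: "\<Theta> (X + Y) = \<Theta> X + \<Theta> Y"
    and bracket_map: "bracket (gm_mult G) k (\<Theta> X) X = 0"
    and kcenter_A: "kcenter ((*) :: 'a \<Rightarrow> 'a \<Rightarrow> 'a) k \<subseteq> proj_A ` center (gm_mult G)"
    and kcenter_B: "kcenter ((*) :: 'b \<Rightarrow> 'b \<Rightarrow> 'b) k \<subseteq> proj_B ` center (gm_mult G)"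
begin

lemma faithful_A_eq: "(\<And>m. actAM G a m = actAM G a' m) \<Longrightarrow> a = a'"
  using faithful_A[of "a - a'"] by (simp add: M.lact_diff_left)

lemma faithful_B_eq: "(\<And>m. actMB G m b = actMB G m b') \<Longrightarrow> b = b'"
  using faithful_B[of "b - b'"] by (simp add: M.ract_diff_right)

text \<open>Faithfulness turns intertwining into commutation:
  \<open>(ax)m = (xm)b = x(mb) = (xa)m\<close>, and similarly for \<open>b\<close>.\<close>

lemma centerI:
  assumes M: "\<And>m. actAM G a m = actMB G m b" and N: "\<And>n. actNA G n a = actBN G b n"
  shows "(a, 0, 0, b) \<in> center (gm_mult G)"
proof -
  have "a * x = x * a" for x
    by (rule faithful_A_eq) (simp add: M.lact_mult M M.lact_ract)
  moreover have "b * x = x * b" for x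
    by (rule faithful_B_eq) (simp add: M.ract_mult M.lact_ract flip: M)
  ultimately show ?thesis using M N by (simp add: center_iff center_def)
qed

text \<open>The form in which condition (1) is applied: a k-central entry can be completed to a
  central diagonal matrix.\<close>

lemma kcenter_A_cases:
  assumes "a \<in> kcenter (*) k"
  obtains b where "(a, 0, 0, b) \<in> center (gm_mult G)"
proof -
  obtain X where X: "X \<in> center (gm_mult G)" "a = proj_A X"
    using assms kcenter_A by blast
  then show thesis by (elim center_cases) (use X that in auto)
qed

lemma kcenter_B_cases:
  assumes "b \<in> kcenter (*) k"
  obtains a where "(a, 0, 0, b) \<in> center (gm_mult G)"
proof -
  obtain X where X: "X \<in> center (gm_mult G)" "b = proj_B X"
    using assms kcenter_B by blast
  then show thesis by (elim center_cases) (use X that in auto)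
qed

lemma map_zero: "\<Theta> 0 = 0"
  using map_add[of 0 0] by simp

lemma map_minus: "\<Theta> (- X) = - \<Theta> X"
  using map_add[of X "- X"] by (simp add: map_zero eq_neg_iff_add_eq_0 add.commute)

lemma map_split: "\<Theta> (a, m, n, b) = \<Theta> (a, 0, 0, 0) + \<Theta> (0, m, 0, 0) + \<Theta> (0, 0, n, 0) + \<Theta> (0, 0, 0, b)"
  by (simp flip: map_add)

lemma map_minus_M: "\<Theta> (0, - m, 0, 0) = - \<Theta> (0, m, 0, 0)"
  using map_minus[of "(0, m, 0, 0)"] by simp

lemma map_minus_N: "\<Theta> (0, 0, - n, 0) = - \<Theta> (0, 0, n, 0)"
  using map_minus[of "(0, 0, n, 0)"] by simp

lemma map_zero_tuple [simp]: "\<Theta> (0, 0, 0, 0) = (0, 0, 0, 0)"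
  using map_zero by (simp add: zero_prod_def)

lemma map_idempotent_commute:
  "gm_mult G p p = p \<Longrightarrow> gm_mult G (\<Theta> p) p = gm_mult G p (\<Theta> p)"
  using gm.bracket_idempotent_commute[OF _ bracket_map k_pos] .

lemma map_unit_A: obtains a b where "\<Theta> (1, 0, 0, 0) = (a, 0, 0, b)"
proof -
  obtain a m n b where eq: "\<Theta> (1, 0, 0, 0) = (a, m, n, b)" by (metis prod_cases4)
  have "m = 0" "n = 0"
    using map_idempotent_commute[of "(1, 0, 0, 0)"] by (simp_all add: eq gma_simps)
  then show thesis using eq that by simp
qed

lemma map_unit_B: obtains a b where "\<Theta> (0, 0, 0, 1) = (a, 0, 0, b)"
proof -
  obtain a m n b where eq: "\<Theta> (0, 0, 0, 1) = (a, m, n, b)" by (metis prod_cases4)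
  have "m = 0" "n = 0"
    using map_idempotent_commute[of "(0, 0, 0, 1)"] by (simp_all add: eq gma_simps)
  then show thesis using eq that by simp
qed

lemma torsion_M_eq: "x + x = y + y \<Longrightarrow> x = (y::'m)"
  using torsion_M[of "x - y"] by (simp add: algebra_simps)

lemma torsion_N_eq: "x + x = y + y \<Longrightarrow> x = (y::'n)"
  using torsion_N[of "x - y"] by (simp add: algebra_simps)

text \<open>The matrices \<open>(1, m, 0, 0)\<close>, \<open>(1, -m, 0, 0)\<close> and
  \<open>(0, m, 0, 1)\<close> are idempotent, so they commute with their images. Adding the first
  two relations gives \<open>2dm = 2mz\<close>; the first and third then give the two expressions
  for the corner entry.\<close>

lemma map_M:
  assumes e: "\<Theta> (1, 0, 0, 0) = (a\<^sub>1, 0, 0, b\<^sub>1)" and f: "\<Theta> (0, 0, 0, 1) = (a\<^sub>2, 0, 0, b\<^sub>2)"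
  obtains d z where "\<Theta> (0, m, 0, 0) = (d, actAM G a\<^sub>1 m - actMB G m b\<^sub>1, 0, z)"
    "actAM G a\<^sub>1 m - actMB G m b\<^sub>1 = actMB G m b\<^sub>2 - actAM G a\<^sub>2 m"
    "actAM G d m = actMB G m z"
proof -
  obtain d t u z where eq: "\<Theta> (0, m, 0, 0) = (d, t, u, z)" by (metis prod_cases4)
  have 1: "\<Theta> (1, m, 0, 0) = (a\<^sub>1 + d, t, u, b\<^sub>1 + z)"
    and 2: "\<Theta> (1, - m, 0, 0) = (a\<^sub>1 - d, - t, - u, b\<^sub>1 - z)"
    and 3: "\<Theta> (0, m, 0, 1) = (d + a\<^sub>2, t, u, z + b\<^sub>2)"
    using map_split[of 1 m 0 0] map_split[of 1 "- m" 0 0] map_split[of 0 m 0 1]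
    by (simp_all add: eq e f map_minus_M)
  have c1: "u = 0" "actAM G a\<^sub>1 m + actAM G d m = t + (actMB G m b\<^sub>1 + actMB G m z)"
    using map_idempotent_commute[of "(1, m, 0, 0)"] by (simp_all add: 1 gma_simps)
  have c2: "actAM G d m - actAM G a\<^sub>1 m = - t + (actMB G m z - actMB G m b\<^sub>1)"
    using map_idempotent_commute[of "(1, - m, 0, 0)"] by (simp add: 2 gma_simps)
  have c3: "actAM G d m + actAM G a\<^sub>2 m + t = actMB G m z + actMB G m b\<^sub>2"
    using map_idempotent_commute[of "(0, m, 0, 1)"] by (simp add: 3 gma_simps)
  have dz: "actAM G d m = actMB G m z"
    by (rule torsion_M_eq) (use arg_cong2[OF c1(2) c2, of "(+)"] in \<open>simp add: algebra_simps\<close>)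
  have t: "t = actAM G a\<^sub>1 m - actMB G m b\<^sub>1"
    using c1(2) by (simp add: dz algebra_simps)
  have "t = actMB G m b\<^sub>2 - actAM G a\<^sub>2 m"
    using c3 by (simp add: dz algebra_simps)
  with t dz c1(1) eq show thesis using that by metis
qed

lemma map_N:
  assumes e: "\<Theta> (1, 0, 0, 0) = (a\<^sub>1, 0, 0, b\<^sub>1)" and f: "\<Theta> (0, 0, 0, 1) = (a\<^sub>2, 0, 0, b\<^sub>2)"
  obtains d z where "\<Theta> (0, 0, n, 0) = (d, 0, actNA G n a\<^sub>1 - actBN G b\<^sub>1 n, z)"
    "actNA G n a\<^sub>1 - actBN G b\<^sub>1 n = actBN G b\<^sub>2 n - actNA G n a\<^sub>2"
proof -
  obtain d t u z where eq: "\<Theta> (0, 0, n, 0) = (d, t, u, z)" by (metis prod_cases4)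
  have 1: "\<Theta> (1, 0, n, 0) = (a\<^sub>1 + d, t, u, b\<^sub>1 + z)"
    and 2: "\<Theta> (1, 0, - n, 0) = (a\<^sub>1 - d, - t, - u, b\<^sub>1 - z)"
    and 3: "\<Theta> (0, 0, n, 1) = (d + a\<^sub>2, t, u, z + b\<^sub>2)"
    using map_split[of 1 0 n 0] map_split[of 1 0 "- n" 0] map_split[of 0 0 n 1]
    by (simp_all add: eq e f map_minus_N)
  have c1: "t = 0" "u + (actBN G b\<^sub>1 n + actBN G z n) = actNA G n a\<^sub>1 + actNA G n d"
    using map_idempotent_commute[of "(1, 0, n, 0)"] by (simp_all add: 1 gma_simps)
  have c2: "- u + (actBN G z n - actBN G b\<^sub>1 n) = actNA G n d - actNA G n a\<^sub>1"
    using map_idempotent_commute[of "(1, 0, - n, 0)"] by (simp add: 2 gma_simps)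
  have c3: "actBN G z n + actBN G b\<^sub>2 n = actNA G n d + actNA G n a\<^sub>2 + u"
    using map_idempotent_commute[of "(0, 0, n, 1)"] by (simp add: 3 gma_simps)
  have dz: "actBN G z n = actNA G n d"
    by (rule torsion_N_eq) (use arg_cong2[OF c1(2) c2, of "(+)"] in \<open>simp add: algebra_simps\<close>)
  have t: "u = actNA G n a\<^sub>1 - actBN G b\<^sub>1 n"
    using c1(2) by (simp add: dz algebra_simps)
  have "u = actBN G b\<^sub>2 n - actNA G n a\<^sub>2"
    using c3 by (simp add: dz algebra_simps)
  with t c1(1) eq show thesis using that by metis
qed

lemma map_A_diagonal: obtains d z where "\<Theta> (a, 0, 0, 0) = (d, 0, 0, z)"
proof -
  obtain d t u z where eq: "\<Theta> (a, 0, 0, 0) = (d, t, u, z)" by (metis prod_cases4)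
  obtain d' z' where f: "\<Theta> (0, 0, 0, 1) = (d', 0, 0, z')" by (rule map_unit_B)
  have eq': "\<Theta> (a, 0, 0, 1) = (d + d', t, u, z + z')"
    using map_split[of a 0 0 1] by (simp add: eq f)
  have 0: "((\<lambda>u. - actAM G a u) ^^ k) t = 0" "((\<lambda>v. actNA G v a) ^^ k) u = 0"
    using bracket_map[of "(a, 0, 0, 0)"] by (simp_all add: eq bracket_diagonal zero_prod_def)
  have 1: "((\<lambda>u. u - actAM G a u) ^^ k) t = 0" "((\<lambda>v. actNA G v a - v) ^^ k) u = 0"
    using bracket_map[of "(a, 0, 0, 1)"]
    by (simp_all add: eq' bracket_diagonal zero_prod_def M.ract_one N.lact_one)
  have "t = 0"
    by (rule funpow_comaximal[OF _ 0(1)]) (use 1(1) in \<open>simp_all add: gma_simps\<close>)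
  \<comment> \<open>The roles are exchanged here: \<open>T\<close> sends \<open>v\<close> to
    \<open>va - v\<close>, and \<open>T + 1\<close> is right multiplication by
    \<open>a\<close>.\<close>
  moreover have "u = 0"
    by (rule funpow_comaximal[OF _ 1(2)]) (use 0(2) in \<open>simp_all add: gma_simps\<close>)
  ultimately show thesis using eq that by simp
qed

lemma map_B_diagonal: obtains d z where "\<Theta> (0, 0, 0, b) = (d, 0, 0, z)"
proof -
  obtain d t u z where eq: "\<Theta> (0, 0, 0, b) = (d, t, u, z)" by (metis prod_cases4)
  obtain d' z' where e: "\<Theta> (1, 0, 0, 0) = (d', 0, 0, z')" by (rule map_unit_A)
  have eq': "\<Theta> (1, 0, 0, b) = (d' + d, t, u, z' + z)"
    using map_split[of 1 0 0 b] by (simp add: eq e)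
  have 0: "((\<lambda>u. actMB G u b) ^^ k) t = 0" "((\<lambda>v. - actBN G b v) ^^ k) u = 0"
    using bracket_map[of "(0, 0, 0, b)"] by (simp_all add: eq bracket_diagonal zero_prod_def)
  have 1: "((\<lambda>u. actMB G u b - u) ^^ k) t = 0" "((\<lambda>v. v - actBN G b v) ^^ k) u = 0"
    using bracket_map[of "(1, 0, 0, b)"]
    by (simp_all add: eq' bracket_diagonal zero_prod_def M.lact_one N.ract_one)
  have "t = 0"
    by (rule funpow_comaximal[OF _ 1(1)]) (use 0(1) in \<open>simp_all add: gma_simps\<close>)
  moreover have "u = 0"
    by (rule funpow_comaximal[OF _ 0(2)]) (use 1(2) in \<open>simp_all add: gma_simps\<close>)
  ultimately show thesis using eq that by simp
qed

text \<open>For any \<open>b\<close>, compare the \<open>B\<close> corner of the k-commuting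
  identity at \<open>diag(a, b)\<close> with that at \<open>diag(0, b)\<close>: the difference is
  the bracket of \<open>z\<close> with \<open>b\<close>.\<close>

lemma map_A_kcenter:
  assumes a: "\<Theta> (a, 0, 0, 0) = (d, 0, 0, z)"
  shows "z \<in> kcenter (*) k"
  unfolding kcenter_def
proof (intro CollectI allI)
  fix b
  obtain d' z' where b: "\<Theta> (0, 0, 0, b) = (d', 0, 0, z')" by (rule map_B_diagonal)
  have "\<Theta> (a, 0, 0, b) = (d + d', 0, 0, z + z')"
    using map_split[of a 0 0 b] by (simp add: a b)
  then have "bracket (*) k (z + z') b = 0" "bracket (*) k z' b = 0"
    using bracket_map[of "(a, 0, 0, b)"] bracket_map[of "(0, 0, 0, b)"]
    by (simp_all add: b bracket_diagonal zero_prod_def)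
  then show "bracket (*) k z b = 0" by (simp add: B.bracket_add)
qed

lemma map_B_kcenter:
  assumes b: "\<Theta> (0, 0, 0, b) = (d, 0, 0, z)"
  shows "d \<in> kcenter (*) k"
  unfolding kcenter_def
proof (intro CollectI allI)
  fix a
  obtain d' z' where a: "\<Theta> (a, 0, 0, 0) = (d', 0, 0, z')" by (rule map_A_diagonal)
  have "\<Theta> (a, 0, 0, b) = (d' + d, 0, 0, z' + z)"
    using map_split[of a 0 0 b] by (simp add: a b)
  then have "bracket (*) k (d' + d) a = 0" "bracket (*) k d' a = 0"
    using bracket_map[of "(a, 0, 0, b)"] bracket_map[of "(a, 0, 0, 0)"]
    by (simp_all add: a bracket_diagonal zero_prod_def)
  then show "bracket (*) k d a = 0" by (simp add: A.bracket_add)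
qed

text \<open>The multiplier is read off the off-diagonal entries, which depend only on the images of the
  two diagonal idempotents.\<close>

lemma diagonal_modulo_multiplier:
  obtains c where "c \<in> center (gm_mult G)"
    "\<And>X. \<exists>d z. \<Theta> X - gm_mult G c X = (d, 0, 0, z)"
proof -
  obtain a\<^sub>1 b\<^sub>1 where e: "\<Theta> (1, 0, 0, 0) = (a\<^sub>1, 0, 0, b\<^sub>1)" by (rule map_unit_A)
  obtain a\<^sub>2 b\<^sub>2 where f: "\<Theta> (0, 0, 0, 1) = (a\<^sub>2, 0, 0, b\<^sub>2)" by (rule map_unit_B)
  obtain c\<^sub>1 where c\<^sub>1: "(c\<^sub>1, 0, 0, b\<^sub>1) \<in> center (gm_mult G)"
    using map_A_kcenter[OF e] by (rule kcenter_B_cases)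
  obtain c\<^sub>2 where c\<^sub>2: "(a\<^sub>2, 0, 0, c\<^sub>2) \<in> center (gm_mult G)"
    using map_B_kcenter[OF f] by (rule kcenter_A_cases)
  \<comment> \<open>Subtracting the central completions leaves \<open>diag(p, 0)\<close> from the
    image of the first idempotent and \<open>diag(0, q)\<close> from that of the second. Together
    they form the multiplier \<open>diag(p, q)\<close>.\<close>
  define p q where "p = a\<^sub>1 - c\<^sub>1" and "q = b\<^sub>2 - c\<^sub>2"
  have tM: "actAM G a\<^sub>1 m - actMB G m b\<^sub>1 = actAM G p m" for m
    using c\<^sub>1 by (simp add: center_iff p_def gma_simps)
  have tN: "actNA G n a\<^sub>1 - actBN G b\<^sub>1 n = actNA G n p" for n
    using c\<^sub>1 by (simp add: center_iff p_def gma_simps)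
  have "actAM G p m = actMB G m q" for m
  proof -
    have "actAM G a\<^sub>1 m - actMB G m b\<^sub>1 = actMB G m b\<^sub>2 - actAM G a\<^sub>2 m"
      by (rule map_M[OF e f])
    then show ?thesis using c\<^sub>2 by (simp add: tM center_iff q_def gma_simps)
  qed
  moreover have "actNA G n p = actBN G q n" for n
  proof -
    have "actNA G n a\<^sub>1 - actBN G b\<^sub>1 n = actBN G b\<^sub>2 n - actNA G n a\<^sub>2"
      by (rule map_N[OF e f])
    then show ?thesis using c\<^sub>2 by (simp add: tN center_iff q_def gma_simps)
  qed
  ultimately have c: "(p, 0, 0, q) \<in> center (gm_mult G)" and qN: "\<And>n. actBN G q n = actNA G n p"
    using centerI by simp_all
  show thesis
  proof (rule that[OF c])
    fix X :: "('a, 'b, 'm, 'n) gmat"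
    obtain a m n b where X: "X = (a, m, n, b)" by (metis prod_cases4)
    obtain d\<^sub>1 z\<^sub>1 where 1: "\<Theta> (a, 0, 0, 0) = (d\<^sub>1, 0, 0, z\<^sub>1)" by (rule map_A_diagonal)
    obtain d\<^sub>2 z\<^sub>2 where 2: "\<Theta> (0, m, 0, 0) = (d\<^sub>2, actAM G p m, 0, z\<^sub>2)"
      using map_M[OF e f, of m] by (metis tM)
    obtain d\<^sub>3 z\<^sub>3 where 3: "\<Theta> (0, 0, n, 0) = (d\<^sub>3, 0, actNA G n p, z\<^sub>3)"
      using map_N[OF e f, of n] by (metis tN)
    obtain d\<^sub>4 z\<^sub>4 where 4: "\<Theta> (0, 0, 0, b) = (d\<^sub>4, 0, 0, z\<^sub>4)" by (rule map_B_diagonal)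
    show "\<exists>d z. \<Theta> X - gm_mult G (p, 0, 0, q) X = (d, 0, 0, z)"
      by (simp add: X map_split[of a m n b] 1 2 3 4 qN)
  qed
qed

end

section \<open>Centrality of diagonal-valued maps on the diagonal corners\<close>

locale diagonal_k_commuting_gma = k_commuting_gma +
  assumes diagonal: "\<exists>d z. \<Theta> X = (d, 0, 0, z)"
begin

definition D where "D X = proj_A (\<Theta> X)"
definition E where "E X = proj_B (\<Theta> X)"

lemma map_eq: "\<Theta> X = (D X, 0, 0, E X)"
  using diagonal[of X] by (auto simp: D_def E_def)

lemma D_split: "D (a, m, n, b) = D (a, 0, 0, 0) + D (0, m, 0, 0) + D (0, 0, n, 0) + D (0, 0, 0, b)"
  and E_split: "E (a, m, n, b) = E (a, 0, 0, 0) + E (0, m, 0, 0) + E (0, 0, n, 0) + E (0, 0, 0, b)"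
  using map_split[of a m n b] by (simp_all add: map_eq)

lemma DE_zero [simp]: "D (0, 0, 0, 0) = 0" "E (0, 0, 0, 0) = 0"
  by (simp_all add: D_def E_def)

lemma DE_add: "D (X + Y) = D X + D Y" "E (X + Y) = E X + E Y"
  using map_add[of X Y] by (simp_all add: map_eq)

lemma DE_minus: "D (- X) = - D X" "E (- X) = - E X"
  using map_minus[of X] by (simp_all add: map_eq)

lemma DE_M_diff: "D (0, m - m', 0, 0) = D (0, m, 0, 0) - D (0, m', 0, 0)"
    "E (0, m - m', 0, 0) = E (0, m, 0, 0) - E (0, m', 0, 0)"
  using DE_add[of "(0, m - m', 0, 0)" "(0, m', 0, 0)"] by simp_all

lemma DE_M_minus: "D (0, - m, 0, 0) = - D (0, m, 0, 0)" "E (0, - m, 0, 0) = - E (0, m, 0, 0)"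
  using DE_minus[of "(0, m, 0, 0)"] by simp_all

lemma DE_N_minus: "D (0, 0, - n, 0) = - D (0, 0, n, 0)" "E (0, 0, - n, 0) = - E (0, 0, n, 0)"
  using DE_minus[of "(0, 0, n, 0)"] by simp_all

text \<open>Diagonality forces the off-diagonal entries computed in \<open>map_M\<close> and
  \<open>map_N\<close> to vanish, which is exactly intertwining for the images of the two
  idempotents.\<close>

lemma map_unit_central:
  "\<Theta> (1, 0, 0, 0) \<in> center (gm_mult G)" "\<Theta> (0, 0, 0, 1) \<in> center (gm_mult G)"
proof -
  note e = map_eq[of "(1, 0, 0, 0)"] and f = map_eq[of "(0, 0, 0, 1)"]
  have M: "actAM G (D (1, 0, 0, 0)) m - actMB G m (E (1, 0, 0, 0)) = 0"
    "actMB G m (E (0, 0, 0, 1)) - actAM G (D (0, 0, 0, 1)) m = 0" for m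
    by (rule map_M[OF e f, of m]; use map_eq[of "(0, m, 0, 0)"] in simp)+
  have N: "actNA G n (D (1, 0, 0, 0)) - actBN G (E (1, 0, 0, 0)) n = 0"
    "actBN G (E (0, 0, 0, 1)) n - actNA G n (D (0, 0, 0, 1)) = 0" for n
    by (rule map_N[OF e f, of n]; use map_eq[of "(0, 0, n, 0)"] in simp)+
  show "\<Theta> (1, 0, 0, 0) \<in> center (gm_mult G)"
    by (subst e, rule centerI) (use M N in simp_all)
  show "\<Theta> (0, 0, 0, 1) \<in> center (gm_mult G)"
    by (subst f, rule centerI) (use M N in simp_all)
qed

lemma commute_M: "actAM G (D (0, m, 0, 0)) m = actMB G m (E (0, m, 0, 0))"
  by (rule map_M[OF map_eq map_eq, of m]) (use map_eq[of "(0, m, 0, 0)"] in simp)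

text \<open>Compare the conjugates of \<open>diag(a, 0)\<close> and \<open>diag(a, 1)\<close> by \<open>(1, w, 0, 1)\<close>.\<close>

lemma map_A_central: "\<Theta> (a, 0, 0, 0) \<in> center (gm_mult G)"
proof -
  \<comment> \<open>This is the upper right entry of the image of \<open>X\<close> after conjugation
    by \<open>(1, w, 0, 1)\<close>; it vanishes when the image intertwines at
    \<open>w\<close>.\<close>
  define v where "v X w = actMB G w (E X) - actAM G (D X) w" for X w
  have v_zero: "v (a, 0, 0, 0) w + v (0, actAM G a w, 0, 0) w = 0" (is "?v = 0") for w
  proof (rule funpow_comaximal)
    let ?X = "(a, actAM G a w, 0, 0)" and ?Y = "(a, actAM G a w - w, 0, 1)"
    have "v ?X w = ?v"
      using D_split[of a "actAM G a w" 0 0] E_split[of a "actAM G a w" 0 0]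
      by (simp add: v_def gma_simps)
    then show "((\<lambda>u. - actAM G a u) ^^ k) ?v = 0"
      using bracket_conjugate_diagonal[of k "D ?X" "E ?X" a w 0] bracket_map[of ?X]
      by (simp add: v_def flip: map_eq)
    have "v ?Y w = ?v"
      using D_split[of a "actAM G a w - w" 0 1] E_split[of a "actAM G a w - w" 0 1]
        map_unit_central(2) commute_M[of w] map_eq[of "(0, 0, 0, 1)"]
      by (simp add: v_def center_iff DE_M_diff gma_simps)
    then show "((\<lambda>u. - actAM G a u + u) ^^ k) ?v = 0"
      using bracket_conjugate_diagonal[of k "D ?Y" "E ?Y" a w 1] bracket_map[of ?Y]
      by (simp add: v_def M.ract_one flip: map_eq)
  qed (simp add: gma_simps)
  have comm: "actAM G (D (a, 0, 0, 0)) w = actMB G w (E (a, 0, 0, 0))" for w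
  proof -
    \<comment> \<open>The first summand of \<open>v_zero\<close> is odd in \<open>w\<close> and the
      second is even, so passing to \<open>- w\<close> separates them up to a factor 2.\<close>
    have "v (a, 0, 0, 0) (- w) = - v (a, 0, 0, 0) w"
      "v (0, actAM G a (- w), 0, 0) (- w) = v (0, actAM G a w, 0, 0) w"
      by (simp_all add: v_def DE_M_minus gma_simps)
    then have "v (a, 0, 0, 0) w + v (a, 0, 0, 0) w = 0"
      using v_zero[of w] v_zero[of "- w"] by (simp add: algebra_simps)
    then have "v (a, 0, 0, 0) w = 0" by (rule torsion_M)
    then show ?thesis by (simp add: v_def)
  qed
  \<comment> \<open>Only the relation on \<open>M\<close> is known so far. The completion from
    condition (2) brings the relation on \<open>N\<close>, and faithfulness identifies
    \<open>c\<close>.\<close>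
  obtain c where c: "(c, 0, 0, E (a, 0, 0, 0)) \<in> center (gm_mult G)"
    using map_A_kcenter[OF map_eq] by (rule kcenter_B_cases)
  then have "c = D (a, 0, 0, 0)"
    by (intro faithful_A_eq) (simp add: center_iff comm)
  with c show ?thesis by (simp flip: map_eq)
qed

text \<open>The same comparison with the conjugates of \<open>diag(0, b)\<close> and
  \<open>diag(1, b)\<close>.\<close>

lemma map_B_central: "\<Theta> (0, 0, 0, b) \<in> center (gm_mult G)"
proof -
  define v where "v X w = actMB G w (E X) - actAM G (D X) w" for X w
  have v_zero: "v (0, 0, 0, b) w - v (0, actMB G w b, 0, 0) w = 0" (is "?v = 0") for w
  proof (rule funpow_comaximal)
    let ?X = "(0, - actMB G w b, 0, b)" and ?Y = "(1, w - actMB G w b, 0, b)"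
    have "v ?Y w = ?v"
      using D_split[of 1 "w - actMB G w b" 0 b] E_split[of 1 "w - actMB G w b" 0 b]
        map_unit_central(1) commute_M[of w] map_eq[of "(1, 0, 0, 0)"]
      by (simp add: v_def center_iff DE_M_diff gma_simps)
    then show "((\<lambda>u. actMB G u b - u) ^^ k) ?v = 0"
      using bracket_conjugate_diagonal[of k "D ?Y" "E ?Y" 1 w b] bracket_map[of ?Y]
      by (simp add: v_def M.lact_one flip: map_eq)
    have "v ?X w = ?v"
      using D_split[of 0 "- actMB G w b" 0 b] E_split[of 0 "- actMB G w b" 0 b]
      by (simp add: v_def DE_M_minus gma_simps)
    then show "((\<lambda>u. actMB G u b - u + u) ^^ k) ?v = 0"
      using bracket_conjugate_diagonal[of k "D ?X" "E ?X" 0 w b] bracket_map[of ?X]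
      by (simp add: v_def flip: map_eq)
  qed (simp add: gma_simps)
  have comm: "actAM G (D (0, 0, 0, b)) w = actMB G w (E (0, 0, 0, b))" for w
  proof -
    have "v (0, 0, 0, b) (- w) = - v (0, 0, 0, b) w"
      "v (0, actMB G (- w) b, 0, 0) (- w) = v (0, actMB G w b, 0, 0) w"
      by (simp_all add: v_def DE_M_minus gma_simps)
    then have "v (0, 0, 0, b) w + v (0, 0, 0, b) w = 0"
      using v_zero[of w] v_zero[of "- w"] by (simp add: neg_eq_iff_add_eq_0)
    then have "v (0, 0, 0, b) w = 0" by (rule torsion_M)
    then show ?thesis by (simp add: v_def)
  qed
  obtain c where c: "(D (0, 0, 0, b), 0, 0, c) \<in> center (gm_mult G)"
    using map_B_kcenter[OF map_eq] by (rule kcenter_A_cases)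
  then have "c = E (0, 0, 0, b)"
    by (intro faithful_B_eq) (simp add: center_iff flip: comm)
  with c show ?thesis by (simp flip: map_eq)
qed

section \<open>Centrality on the off-diagonal corners\<close>

lemma bracket_D_A: "bracket (*) k (D (a, 0, 0, 0)) a' = 0"
  using map_A_central[of a] map_eq[of "(a, 0, 0, 0)"] k_pos
  by (intro A.bracket_commuting_eq_0) (simp_all add: center_iff center_def)

lemma bracket_E_B: "bracket (*) k (E (0, 0, 0, b)) b' = 0"
  using map_B_central[of b] map_eq[of "(0, 0, 0, b)"] k_pos
  by (intro B.bracket_commuting_eq_0) (simp_all add: center_iff center_def)

text \<open>The \<open>A\<close> entry of the identity at \<open>(a, m, 0, 0)\<close> brackets
  \<open>D (a, 0, 0, 0) + D (0, m, 0, 0)\<close> with \<open>a\<close>, and the first summand is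
  central in \<open>A\<close>. The second claim uses \<open>(0, m, 0, b)\<close>.\<close>

lemma map_M_kcenter: "D (0, m, 0, 0) \<in> kcenter (*) k" "E (0, m, 0, 0) \<in> kcenter (*) k"
proof -
  have "bracket (*) k (D (0, m, 0, 0)) a = 0" for a
    using bracket_upper[of k "D (a, m, 0, 0)" 0 "E (a, m, 0, 0)" a m 0]
      bracket_map[of "(a, m, 0, 0)", unfolded map_eq[of "(a, m, 0, 0)"]] D_split[of a m 0 0] bracket_D_A[of a a]
    by (simp add: zero_prod_def A.bracket_add)
  moreover have "bracket (*) k (E (0, m, 0, 0)) b = 0" for b
    using bracket_upper[of k "D (0, m, 0, b)" 0 "E (0, m, 0, b)" 0 m b]
      bracket_map[of "(0, m, 0, b)", unfolded map_eq[of "(0, m, 0, b)"]] E_split[of 0 m 0 b] bracket_E_B[of b b]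
    by (simp add: zero_prod_def B.bracket_add)
  ultimately show "D (0, m, 0, 0) \<in> kcenter (*) k" "E (0, m, 0, 0) \<in> kcenter (*) k"
    by (simp_all add: kcenter_def)
qed

lemma map_N_kcenter: "E (0, 0, n, 0) \<in> kcenter (*) k"
proof -
  have "bracket (*) k (E (0, 0, n, 0)) b = 0" for b
    using bracket_lower[of k "D (0, 0, n, b)" 0 "E (0, 0, n, b)" 0 n b]
      bracket_map[of "(0, 0, n, b)", unfolded map_eq[of "(0, 0, n, b)"]] E_split[of 0 0 n b] bracket_E_B[of b b]
    by (simp add: zero_prod_def B.bracket_add)
  then show ?thesis by (simp add: kcenter_def)
qed

lemma map_M_center: "D (0, m, 0, 0) \<in> center (*)" "E (0, m, 0, 0) \<in> center (*)"
  using map_M_kcenter[of m] by (auto elim!: kcenter_A_cases kcenter_B_cases simp: center_iff)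

text \<open>Conjugating \<open>(1, 0, 0, 0)\<close> by \<open>(1, m, 0, 1)\<close> and then by \<open>(1, 0, n, 1)\<close> gives the idempotent
  used here, which couples the two off-diagonal corners.\<close>

lemma idempotent_relations:
  fixes m n
  defines "n' \<equiv> n + actNA G n (prodMN G m n)"
  shows "actAM G (D (0, 0, n', 0)) m = actMB G m (E (0, 0, n', 0))"
    and "actNA G n' (D (0, m, 0, 0)) - actBN G (E (0, m, 0, 0)) n' =
         actNA G n' (D (0, 0, n', 0)) - actBN G (E (0, 0, n', 0)) n'"
proof -
  let ?p = "(1 + prodMN G m n, m, - n', - prodNM G n m)"
  have "gm_mult G ?p ?p = ?p"
    by (simp add: n'_def gma_simps MN_right NM_left NM_right NM_balanced M.lact_mult N.ract_mult
        M.ract_mult N.lact_mult MNM NMN algebra_simps)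
  then have comm: "gm_mult G (\<Theta> ?p) ?p = gm_mult G ?p (\<Theta> ?p)"
    by (rule map_idempotent_commute)
  define a b where "a = 1 + prodMN G m n" and "b = - prodNM G n m"
  have p: "D ?p = D (a, 0, 0, 0) + D (0, m, 0, 0) - D (0, 0, n', 0) + D (0, 0, 0, b)"
    "E ?p = E (a, 0, 0, 0) + E (0, m, 0, 0) - E (0, 0, n', 0) + E (0, 0, 0, b)"
    using D_split[of a m "- n'" b] E_split[of a m "- n'" b] by (simp_all add: a_def b_def DE_N_minus)
  have eqs: "actAM G (D ?p) m = actMB G m (E ?p)" "actNA G n' (D ?p) = actBN G (E ?p) n'"
    using comm by (simp_all add: map_eq[of ?p] gma_simps)
  \<comment> \<open>The diagonal entries of \<open>?p\<close> have central images, which cancel from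
    \<open>eqs\<close>; only the contributions of \<open>m\<close> and \<open>n'\<close>
    remain.\<close>
  have c: "actAM G (D (a, 0, 0, 0)) x = actMB G x (E (a, 0, 0, 0))"
    "actNA G y (D (a, 0, 0, 0)) = actBN G (E (a, 0, 0, 0)) y"
    "actAM G (D (0, 0, 0, b)) x = actMB G x (E (0, 0, 0, b))"
    "actNA G y (D (0, 0, 0, b)) = actBN G (E (0, 0, 0, b)) y" for x y
    using map_A_central[of a] map_eq[of "(a, 0, 0, 0)"] map_B_central[of b] map_eq[of "(0, 0, 0, b)"]
    by (simp_all add: center_iff)
  show "actAM G (D (0, 0, n', 0)) m = actMB G m (E (0, 0, n', 0))"
    using eqs(1) commute_M[of m] by (simp add: p gma_simps c)
  show "actNA G n' (D (0, m, 0, 0)) - actBN G (E (0, m, 0, 0)) n' =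
      actNA G n' (D (0, 0, n', 0)) - actBN G (E (0, 0, n', 0)) n'"
    using eqs(2) by (simp add: p gma_simps c algebra_simps)
qed

text \<open>The relation for \<open>n + nxn\<close> splits into a part odd in \<open>x\<close> and a
  part even in \<open>x\<close>. Replacing \<open>x\<close> by \<open>- x\<close> isolates the odd
  part, which says that the image of \<open>n\<close> intertwines at \<open>x\<close>.\<close>

lemma map_N_central: "\<Theta> (0, 0, n, 0) \<in> center (gm_mult G)"
proof -
  define v where "v y x = actAM G (D (0, 0, y, 0)) x - actMB G x (E (0, 0, y, 0))" for y x
  have v_add: "v (y + y') x = v y x + v y' x" for y y' x
    using DE_add[of "(0, 0, y, 0)" "(0, 0, y', 0)"] by (simp add: v_def gma_simps)
  have v_minus: "v (- y) x = - v y x" "v y (- x) = - v y x" for y x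
    by (simp_all add: v_def DE_N_minus gma_simps)
  have zero: "v n x + v (actNA G n (prodMN G x n)) x = 0" for x
    unfolding v_add[symmetric] using idempotent_relations(1)[of n x] by (simp add: v_def)
  have "v n x = 0" for x
  proof (rule torsion_M)
    show "v n x + v n x = 0"
      using zero[of x] zero[of "- x"] by (simp add: v_minus gma_simps algebra_simps)
  qed
  then have comm: "actAM G (D (0, 0, n, 0)) x = actMB G x (E (0, 0, n, 0))" for x
    by (simp add: v_def)
  obtain c where c: "(c, 0, 0, E (0, 0, n, 0)) \<in> center (gm_mult G)"
    using map_N_kcenter by (rule kcenter_B_cases)
  then have "c = D (0, 0, n, 0)"
    by (intro faithful_A_eq) (simp add: center_iff comm)
  with c show ?thesis by (simp flip: map_eq)
qed

lemma commute_MN: "actNA G n (D (0, m, 0, 0)) = actBN G (E (0, m, 0, 0)) n"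
proof -
  let ?d = "D (0, m, 0, 0)" and ?z = "E (0, m, 0, 0)"
  let ?n' = "n + actNA G n (prodMN G m n)"
  have d: "?d * x = x * ?d" and z: "?z * y = y * ?z" for x y
    using map_M_center[of m] by (simp_all add: center_def)
  have "actNA G ?n' ?d = actBN G ?z ?n'"
    using idempotent_relations(2)[of n m] map_N_central[of ?n'] map_eq[of "(0, 0, ?n', 0)"]
    by (simp add: center_iff)
  \<comment> \<open>The term \<open>nmn\<close> of \<open>?n'\<close> intertwines by itself: with
    \<open>d\<close> and \<open>z\<close> central in their algebras,
    \<open>nmnd = n(dm)n = n(mz)n = znmn\<close>. Cancelling it leaves the claim for
    \<open>n\<close>.\<close>
  moreover have "actNA G (actNA G n (prodMN G m n)) ?d = actBN G ?z (actNA G n (prodMN G m n))"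
  proof -
    have "prodMN G m n * ?d = prodMN G m (actBN G ?z n)"
      by (simp add: MN_left commute_M flip: d MN_balanced)
        (simp add: d flip: MN_left MN_balanced commute_M)
    then have "actNA G (actNA G n (prodMN G m n)) ?d = actNA G n (prodMN G m (actBN G ?z n))"
      by (simp flip: N.ract_mult)
    also have "\<dots> = actBN G (prodNM G n m * ?z) n"
      by (simp add: N.lact_mult NMN)
    also have "\<dots> = actBN G ?z (actNA G n (prodMN G m n))"
      by (simp add: N.lact_mult NMN flip: z)
    finally show ?thesis .
  qed
  ultimately show ?thesis by (simp add: gma_simps)
qed

lemma map_M_central:
  assumes center: "center (gm_mult G) =
    {(a, 0, 0, b) | a b. a \<in> center (*) \<and> b \<in> center (*) \<and>
      actAM G a m\<^sub>0 = actMB G m\<^sub>0 b \<and> actNA G n\<^sub>0 a = actBN G b n\<^sub>0}"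
  shows "\<Theta> (0, m, 0, 0) \<in> center (gm_mult G)"
proof -
  have reduce: "\<Theta> (0, m, 0, 0) \<in> center (gm_mult G)"
    if "actAM G (D (0, m, 0, 0)) m\<^sub>0 = actMB G m\<^sub>0 (E (0, m, 0, 0))" for m
    using that map_M_center[of m] commute_MN[of n\<^sub>0 m] by (simp add: map_eq[of "(0, m, 0, 0)"] center)
  have "\<Theta> (0, m\<^sub>0, 0, 0) \<in> center (gm_mult G)"
    using commute_M by (rule reduce)
  then have "actAM G (D (0, m\<^sub>0, 0, 0)) m = actMB G m (E (0, m\<^sub>0, 0, 0))"
    using map_eq[of "(0, m\<^sub>0, 0, 0)"] by (simp add: center_iff)
  \<comment> \<open>Expanding \<open>commute_M\<close> at \<open>m + m\<^sub>0\<close>, every term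
    cancels except those in which the image of \<open>m\<close> acts on
    \<open>m\<^sub>0\<close>.\<close>
  then show ?thesis
    using commute_M[of "m + m\<^sub>0"] commute_M[of m] commute_M[of m\<^sub>0]
      DE_add[of "(0, m, 0, 0)" "(0, m\<^sub>0, 0, 0)"]
    by (intro reduce) (simp add: gma_simps algebra_simps)
qed

end

section \<open>Assembling the decomposition\<close>

theorem theorem3p5:
  fixes k :: nat
    and G :: "('r::comm_ring_1, 'a::ring_1, 'b::ring_1, 'm::ab_group_add, 'n::ab_group_add) morita"
    and \<Theta> :: "('a, 'b, 'm, 'n) gmat \<Rightarrow> ('a, 'b, 'm, 'n) gmat"
  assumes "k \<ge> 2"
    and "generalized_matrix_algebra G"
    and two_torsion_free: "\<forall>X :: ('a, 'b, 'm, 'n) gmat. X + X = 0 \<longrightarrow> X = 0"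
    and faithful_left: "\<forall>a. (\<forall>m. actAM G a m = 0) \<longrightarrow> a = 0"
    and faithful_right: "\<forall>b. (\<forall>m. actMB G m b = 0) \<longrightarrow> b = 0"
    and "k_commuting (gm_scale G) (gm_mult G) k \<Theta>"
    and "kcenter ((*) :: 'a \<Rightarrow> 'a \<Rightarrow> 'a) k = proj_A ` center (gm_mult G)"
    and "kcenter ((*) :: 'b \<Rightarrow> 'b \<Rightarrow> 'b) k = proj_B ` center (gm_mult G)"
    and "\<exists>m\<^sub>0 n\<^sub>0. center (gm_mult G) =
           {(a, 0, 0, b) | a b. a \<in> center (*) \<and> b \<in> center (*) \<and>
              actAM G a m\<^sub>0 = actMB G m\<^sub>0 b \<and> actNA G n\<^sub>0 a = actBN G b n\<^sub>0}"
  shows "\<exists>c \<in> center (gm_mult G). \<exists>\<zeta>. module_hom (gm_scale G) (gm_scale G) \<zeta> \<and>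
           range \<zeta> \<subseteq> center (gm_mult G) \<and> (\<forall>X. \<Theta> X = gm_mult G c X + \<zeta> X)"
proof -
  interpret generalized_matrix_algebra G by fact
  have hom: "module_hom (gm_scale G) (gm_scale G) \<Theta>"
    and bracket: "\<And>X. bracket (gm_mult G) k (\<Theta> X) X = 0"
    using assms(6) unfolding k_commuting_def by blast+
  interpret \<Theta>: module_hom "gm_scale G" "gm_scale G" \<Theta> by (rule hom)
  have torsion_M: "x = 0" if "x + x = 0" for x :: 'm
    using two_torsion_free[rule_format, of "(0, x, 0, 0)"] that by (simp add: zero_prod_def)
  have torsion_N: "x = 0" if "x + x = 0" for x :: 'n
    using two_torsion_free[rule_format, of "(0, 0, x, 0)"] that by (simp add: zero_prod_def)
  have faithful_A: "a = 0" if "\<And>m. actAM G a m = 0" for a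
    using faithful_left that by blast
  have faithful_B: "b = 0" if "\<And>m. actMB G m b = 0" for b
    using faithful_right that by blast
  have k_pos: "k \<ge> 1" using assms(1) by simp
  note kcenters = eq_refl[OF assms(7)] eq_refl[OF assms(8)]
  interpret k_commuting_gma G k \<Theta>
    by unfold_locales
      (fact k_pos torsion_M torsion_N faithful_A faithful_B \<Theta>.add bracket kcenters)+
  obtain c where c: "c \<in> center (gm_mult G)" "\<And>X. \<exists>d z. \<Theta> X - gm_mult G c X = (d, 0, 0, z)"
    by (rule diagonal_modulo_multiplier) blast
  define \<zeta> where "\<zeta> X = \<Theta> X - gm_mult G c X" for X
  have comm: "gm_mult G c X = gm_mult G X c" for X
    using c(1) unfolding center_def by blast
  \<comment> \<open>As \<open>c\<close> is central, \<open>cX\<close> commutes with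
    \<open>X\<close>, so subtracting it preserves the k-commuting identity.\<close>
  have "gm_mult G (gm_mult G c X) X = gm_mult G X (gm_mult G c X)" for X
    by (metis comm gm.mult_assoc)
  then have "bracket (gm_mult G) k (gm_mult G c X) X = 0" for X
    using k_pos by (rule gm.bracket_commuting_eq_0)
  then have bracket_\<zeta>: "bracket (gm_mult G) k (\<zeta> X) X = 0" for X
    unfolding \<zeta>_def gm.bracket_diff bracket by simp
  have add_\<zeta>: "\<zeta> (X + Y) = \<zeta> X + \<zeta> Y" for X Y
    unfolding \<zeta>_def \<Theta>.add gm.mult_add_right by simp
  interpret \<zeta>: diagonal_k_commuting_gma G k \<zeta>
    by unfold_locales
      (fact k_pos torsion_M torsion_N faithful_A faithful_B add_\<zeta> bracket_\<zeta> kcenters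
        c(2)[folded \<zeta>_def])+
  have hom_\<zeta>: "module_hom (gm_scale G) (gm_scale G) \<zeta>"
  proof unfold_locales
    show "\<zeta> (gm_scale G r X) = gm_scale G r (\<zeta> X)" for r X
      unfolding \<zeta>_def \<Theta>.scale gm.mult_scale_right gm.scale_right_diff_distrib ..
  qed (rule add_\<zeta>)
  have "\<zeta> X \<in> center (gm_mult G)" for X
  proof -
    obtain a m n b where X: "X = (a, m, n, b)" by (metis prod_cases4)
    have "\<zeta> (0, m, 0, 0) \<in> center (gm_mult G)"
      using assms(9) \<zeta>.map_M_central by blast
    then show ?thesis
      unfolding X \<zeta>.map_split[of a m n b]
      using \<zeta>.map_A_central \<zeta>.map_B_central \<zeta>.map_N_central by (intro gm.center_add)
  qed
  with c(1) hom_\<zeta> show ?thesis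
    by (intro bexI[of _ c] exI[of _ \<zeta>]) (auto simp: \<zeta>_def)
qed

end
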